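(* Let $f(t)$ be the characteristic function of a symmetric infinitely divisible probability distribution on $\mathbb{R}$ with finite second moment $\sigma^2$. Then $$\exp\{-\sigma^2t^2/2\}\le f(t)$$ for all $t\in\mathbb{R}$.
   Context: A characteristic function $f$ is called $m$-divisible, for a positive integer $m$, if $f^{1/m}$ is also a characteristic function, i.e. there is a characteristic function $g$ of a probability distribution on $\mathbb{R}$ with $g^m=f$. It is infinitely divisible if it is $m$-divisible for all positive integers $m$. A distribution on $\mathbb{R}$ is symmetric if it is invariant under $x\mapsto -x$; equivalently, its characteristic function is real-valued and even. *)

theory Defs
  imports "HOL-Probability.Probability"
begin

definition characteristic_function :: "(real \<Rightarrow> complex) \<Rightarrow> bool" where
  "characteristic_function f \<longleftrightarrow> (\<exists>N. real_distribution N \<and> f = char N)"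

(* The m-th root of f is not a fixed branch: some characteristic function g with g^m = f
   is required to exist. *)
definition m_divisible :: "nat \<Rightarrow> (real \<Rightarrow> complex) \<Rightarrow> bool" where
  "m_divisible m f \<longleftrightarrow> (\<exists>g. characteristic_function g \<and> (\<forall>t. g t ^ m = f t))"

definition infinitely_divisible :: "(real \<Rightarrow> complex) \<Rightarrow> bool" where
  "infinitely_divisible f \<longleftrightarrow> (\<forall>m>0. m_divisible m f)"

definition symmetric_distribution :: "real measure \<Rightarrow> bool" where
  "symmetric_distribution M \<longleftrightarrow> distr M borel uminus = M"

end

theory Submission
  imports Defs "HOL-Real_Asymp.Real_Asymp"
begin

text \<open>
  Every characteristic function \<open>g\<close> satisfies \<open>1 - |g(2t)| \<le> 4(1 - |g(t)|)\<close>, by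
  integrating \<open>cos 2\<theta> \<ge> 4 cos \<theta> - 3\<close> after rotating \<open>g(t)\<close> onto the nonnegative real axis; hence
  \<open>1 - |g(t)| \<le> 4^n (1 - |g(t/2^n)|)\<close> for all \<open>n\<close>. If \<open>g^m = f\<close>, then
  \<open>|g(s)| = |f(s)|^(1/m) \<ge> (1 - \<sigma>\<^sup>2s\<^sup>2/2)^(1/m)\<close> for small \<open>s\<close>, and letting \<open>n\<close> tend to infinity gives
  \<open>|f(t)| = |g(t)|^m \<ge> (1 - \<sigma>\<^sup>2t\<^sup>2/(2m))^m\<close>. As \<open>m\<close> tends to infinity, this becomes
  \<open>|f(t)| \<ge> exp(-\<sigma>\<^sup>2t\<^sup>2/2)\<close>; in particular the continuous real function \<open>f\<close> has no zero, so it is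
  positive.
\<close>

lemma (in real_distribution) one_minus_norm_char_double:
  "1 - norm (char M (2 * t)) \<le> 4 * (1 - norm (char M t))"
proof -
  \<comment> \<open>Multiplication by \<open>w\<close> rotates \<open>char M t\<close> onto the nonnegative real axis.\<close>
  obtain w where w: "norm w = 1" "Re (w * char M t) = norm (char M t)"
  proof (cases "char M t = 0")
    case False
    show ?thesis
    proof (rule that[of "cnj (sgn (char M t))"])
      show "norm (cnj (sgn (char M t))) = 1"
        using False by (simp add: norm_sgn)
      have "cnj (sgn (char M t)) * char M t = of_real (norm (char M t))"
        using False complex_norm_square[of "char M t"]
        by (simp add: sgn_div_norm scaleR_conv_of_real power2_eq_square field_simps)
      then show "Re (cnj (sgn (char M t)) * char M t) = norm (char M t)"
        by simp
    qed
  qed (use that[of 1] in simp)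
  have int: "integrable M (\<lambda>x. iexp (s * x))" for s
    by (intro integrable_const_bound[of _ 1]) auto
  then have int_mult: "integrable M (\<lambda>x. u * iexp (s * x))" for u s
    by (rule integrable_mult_right)
  then have int_Re: "integrable M (\<lambda>x. Re (u * iexp (s * x)))" for u s
    by (rule integrable_Re)
  have Re_char: "Re (u * char M s) = expectation (\<lambda>x. Re (u * iexp (s * x)))" for u s
  proof -
    have "u * char M s = (CLINT x|M. u * iexp (s * x))"
      unfolding char_def by (rule integral_mult_right_zero[symmetric])
    then show ?thesis
      by (simp only: integral_Re[OF int_mult])
  qed
  \<comment> \<open>With \<open>z = w * iexp (t * x)\<close> on the unit circle, the right side is
    \<open>Re (z\<^sup>2)\<close> and exceeds the left by \<open>2 * (Re z - 1)\<^sup>2\<close>. The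
    factor \<open>w\<^sup>2\<close> has modulus 1, so it disappears once norms are taken.\<close>
  have pointwise: "4 * Re (w * iexp (t * x)) - 3 \<le> Re (w\<^sup>2 * iexp (2 * t * x))" for x
  proof -
    define z where "z = w * iexp (t * x)"
    have "norm z = 1"
      using w by (simp add: z_def norm_mult)
    then have z: "(Re z)\<^sup>2 + (Im z)\<^sup>2 = 1"
      by (simp add: cmod_def)
    have "w\<^sup>2 * iexp (2 * t * x) = z\<^sup>2"
      by (simp add: z_def power_mult_distrib mult.assoc mult.left_commute flip: exp_double)
    moreover have "4 * Re z - 3 \<le> Re (z\<^sup>2)"
      using z zero_le_power2[of "Re z - 1"] by (simp add: power2_eq_square algebra_simps)
    ultimately show ?thesis
      by (simp add: z_def)
  qed
  have affine: "expectation (\<lambda>x. 4 * h x - 3) = 4 * expectation h - 3" "integrable M (\<lambda>x. 4 * h x - 3)"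
    if "integrable M h" for h :: "real \<Rightarrow> real"
    using that by (simp_all add: prob_space del: space_eq_univ)
  have "4 * norm (char M t) - 3 = expectation (\<lambda>x. 4 * Re (w * iexp (t * x)) - 3)"
    unfolding w(2)[symmetric] Re_char by (rule affine(1)[OF int_Re, symmetric])
  also have "\<dots> \<le> expectation (\<lambda>x. Re (w\<^sup>2 * iexp (2 * t * x)))"
    by (rule integral_mono[OF affine(2)[OF int_Re] int_Re pointwise])
  also have "\<dots> = Re (w\<^sup>2 * char M (2 * t))"
    by (rule Re_char[symmetric])
  also have "\<dots> \<le> norm (w\<^sup>2 * char M (2 * t))"
    by (rule complex_Re_le_cmod)
  also have "\<dots> = norm (char M (2 * t))"
    using w by (simp add: norm_mult norm_power)
  finally show ?thesis
    by simp
qed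

text \<open>Each halving costs a factor 4, which exactly matches quadratic decay: a bound of order
  \<open>s\<^sup>2\<close> near 0 is carried to every \<open>t\<close> without loss.\<close>

lemma (in real_distribution) one_minus_norm_char_dyadic:
  "1 - norm (char M t) \<le> 4 ^ n * (1 - norm (char M (t / 2 ^ n)))"
proof (induction n)
  case (Suc n)
  have "1 - norm (char M (t / 2 ^ n)) \<le> 4 * (1 - norm (char M (t / 2 ^ Suc n)))"
    using one_minus_norm_char_double[of "t / 2 ^ Suc n"] by simp
  then have "4 ^ n * (1 - norm (char M (t / 2 ^ n))) \<le>
      4 ^ n * (4 * (1 - norm (char M (t / 2 ^ Suc n))))"
    by (intro mult_left_mono) auto
  with Suc.IH show ?case
    by (simp only: power_Suc mult_ac)
qed simp

text \<open>Integrates \<open>1 - cos y = 2 * (sin (y / 2))\<^sup>2 \<le> y\<^sup>2 / 2\<close> at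
  \<open>y = t * x\<close>.\<close>

lemma (in real_distribution) Re_char_ge:
  assumes "integrable M (\<lambda>x. x\<^sup>2)"
  shows "1 - expectation (\<lambda>x. x\<^sup>2) * t\<^sup>2 / 2 \<le> Re (char M t)"
proof -
  have int: "integrable M (\<lambda>x. iexp (t * x))"
    by (intro integrable_const_bound[of _ 1]) auto
  have cos_ge: "1 - t\<^sup>2 / 2 * x\<^sup>2 \<le> Re (iexp (t * x))" for x
  proof -
    have "1 - cos (t * x) = 2 * (sin (t * x / 2))\<^sup>2"
      using cos_double_sin[of "t * x / 2"] by simp
    also have "\<dots> \<le> 2 * (t * x / 2)\<^sup>2"
      using abs_sin_x_le_abs_x[of "t * x / 2"] by (simp only: abs_le_square_iff)
    finally show ?thesis
      by (simp add: Re_exp power2_eq_square field_simps)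
  qed
  have "1 - expectation (\<lambda>x. x\<^sup>2) * t\<^sup>2 / 2 = expectation (\<lambda>x. 1 - t\<^sup>2 / 2 * x\<^sup>2)"
    using assms by (simp add: prob_space del: space_eq_univ)
  also have "\<dots> \<le> expectation (\<lambda>x. Re (iexp (t * x)))"
    using assms int
    by (intro integral_mono cos_ge Bochner_Integration.integrable_diff integrable_mult_right
        integrable_Re) auto
  also have "\<dots> = Re (char M t)"
    unfolding char_def using int by simp
  finally show ?thesis .
qed

lemma char_distr_uminus:
  assumes "real_distribution M"
  shows "char (distr M borel uminus) t = cnj (char M t)"
proof -
  interpret real_distribution M by fact
  have "char (distr M borel uminus) t = (CLINT x|M. cnj (iexp (t * x)))"
    unfolding char_def by (subst integral_distr) (auto simp: exp_cnj)
  also have "\<dots> = cnj (char M t)"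
    unfolding char_def by (rule Bochner_Integration.integral_cnj)
  finally show ?thesis .
qed

text \<open>Taking the root of \<open>ge\<close> directly at \<open>t\<close> gives at best
  \<open>(1 - c * t\<^sup>2) powr (1 / m)\<close>. Taking it at \<open>t / 2 ^ n\<close> and scaling
  back by the dyadic inequality replaces this by the tangent line at 0.\<close>

lemma norm_char_root_ge:
  fixes c :: real
  assumes "real_distribution N" "m > 0"
    and ge: "\<And>s. 1 - c * s\<^sup>2 \<le> norm (char N s ^ m)"
  shows "1 - c * t\<^sup>2 / m \<le> norm (char N t)"
proof -
  interpret N: real_distribution N by fact
  define d where "d = c * t\<^sup>2"
  \<comment> \<open>With \<open>u = d / 4 ^ n\<close>, this is \<open>d\<close> times the difference
    quotient at 0 of \<open>1 - (1 - u) powr (1 / m)\<close>, whose derivative there is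
    \<open>1 / m\<close>.\<close>
  have lim: "(\<lambda>n. 4 ^ n * (1 - (1 - d / 4 ^ n) powr (1 / m))) \<longlonglongrightarrow> d / m"
    using \<open>m > 0\<close> by real_asymp
  have small: "eventually (\<lambda>n. 1 - d / 4 ^ n > 0) sequentially"
    by real_asymp
  have "eventually (\<lambda>n. 1 - norm (char N t) \<le> 4 ^ n * (1 - (1 - d / 4 ^ n) powr (1 / m))) sequentially"
    using small
  proof eventually_elim
    case (elim n)
    let ?a = "norm (char N (t / 2 ^ n))"
    have "1 - d / 4 ^ n \<le> ?a ^ m"
      using ge[of "t / 2 ^ n"]
      by (simp add: d_def norm_power power_divide power2_eq_square flip: power_mult_distrib)
    then have "(1 - d / 4 ^ n) powr (1 / m) \<le> (?a ^ m) powr (1 / m)"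
      using elim by (intro powr_mono2) auto
    also have "\<dots> = ?a"
    proof -
      have "?a \<noteq> 0"
        using \<open>1 - d / 4 ^ n \<le> ?a ^ m\<close> elim \<open>m > 0\<close> by (auto simp: zero_power)
      then show ?thesis
        using \<open>m > 0\<close> by (simp add: powr_powr flip: powr_realpow)
    qed
    finally have "4 ^ n * (1 - ?a) \<le> 4 ^ n * (1 - (1 - d / 4 ^ n) powr (1 / m))"
      by (intro mult_left_mono) auto
    with N.one_minus_norm_char_dyadic[of t n] show ?case
      by linarith
  qed
  then have "1 - norm (char N t) \<le> d / m"
    by (rule tendsto_lowerbound[OF lim]) simp
  then show ?thesis
    by (simp add: d_def)
qed

lemma norm_infinitely_divisible_char_ge:
  fixes c :: real
  assumes "infinitely_divisible f" and ge: "\<And>s. 1 - c * s\<^sup>2 \<le> norm (f s)"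
  shows "exp (- (c * t\<^sup>2)) \<le> norm (f t)"
proof -
  define d where "d = c * t\<^sup>2"
  have lim: "(\<lambda>m. (1 + (- d) / real m) ^ m) \<longlonglongrightarrow> exp (- d)"
    by (rule tendsto_exp_limit_sequentially)
  \<comment> \<open>A nonnegative base is what allows the lower bound to be raised to the power
    \<open>m\<close>.\<close>
  have small: "eventually (\<lambda>m. 1 - d / real m > 0) sequentially"
    by real_asymp
  have "eventually (\<lambda>m. (1 + (- d) / real m) ^ m \<le> norm (f t)) sequentially"
    using small eventually_gt_at_top[of 0]
  proof eventually_elim
    case (elim m)
    \<comment> \<open>The root may change with \<open>m\<close> in any way, since only its modulus
      enters.\<close>
    then obtain N where N: "real_distribution N" "\<And>s. char N s ^ m = f s"
      using assms(1)
      unfolding infinitely_divisible_def m_divisible_def characteristic_function_def by metis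
    have "1 - c * t\<^sup>2 / m \<le> norm (char N t)"
      using N elim ge by (intro norm_char_root_ge) auto
    then have "(1 - d / m) ^ m \<le> norm (char N t) ^ m"
      using elim by (intro power_mono) (auto simp: d_def)
    then show ?case
      by (simp add: N(2) flip: norm_power)
  qed
  then have "exp (- d) \<le> norm (f t)"
    by (rule tendsto_upperbound[OF lim]) simp
  then show ?thesis
    by (simp add: d_def)
qed

text \<open>Intermediate values: a nonpositive \<open>h t\<close> together with
  \<open>h a > 0\<close> would put 0 in the connected range.\<close>

lemma continuous_nonzero_pos:
  fixes h :: "real \<Rightarrow> real"
  assumes "continuous_on UNIV h" "\<And>t. h t \<noteq> 0" "h a > 0"
  shows "h t > 0"
proof (rule ccontr)
  assume "\<not> h t > 0"
  moreover have "connected (range h)"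
    using assms(1) by (rule connected_continuous_image) simp
  ultimately have "0 \<in> range h"
    using connectedD_interval[of "range h" "h t" "h a" 0] \<open>h a > 0\<close> by simp
  then show False
    using assms(2) by (metis imageE)
qed

theorem theorem1p5:
  fixes M :: "real measure" and f :: "real \<Rightarrow> complex" and \<sigma> :: real
  assumes "real_distribution M"
    and "f = char M"
    and "symmetric_distribution M"
    and "infinitely_divisible f"
    and "integrable M (\<lambda>x. x\<^sup>2)"
    and "(LINT x|M. x\<^sup>2) = \<sigma>\<^sup>2"
  shows "\<forall>t. f t \<in> \<real> \<and> exp (- (\<sigma>\<^sup>2 * t\<^sup>2 / 2)) \<le> Re (f t)"
proof -
  interpret real_distribution M by fact
  \<comment> \<open>Symmetry makes \<open>f t\<close> equal to its own conjugate.\<close>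
  have real: "f t \<in> \<real>" for t
    using char_distr_uminus[OF assms(1), of t] assms(2,3)
    by (simp add: symmetric_distribution_def Reals_cnj_iff)
  have norm_f: "norm (f t) = \<bar>Re (f t)\<bar>" for t
    using real by (rule in_Reals_norm)
  have "1 - \<sigma>\<^sup>2 / 2 * s\<^sup>2 \<le> norm (f s)" for s
    using Re_char_ge[OF assms(5), of s] complex_Re_le_cmod[of "f s"] assms(2,6) by simp
  from norm_infinitely_divisible_char_ge[OF assms(4) this]
  have bound: "exp (- (\<sigma>\<^sup>2 * t\<^sup>2 / 2)) \<le> \<bar>Re (f t)\<bar>" for t
    by (simp add: norm_f)
  \<comment> \<open>The modulus bound leaves the sign open. Since \<open>exp\<close> is positive,
    \<open>f\<close> has no zero, and continuity propagates the sign of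
    \<open>f 0 = 1\<close>.\<close>
  have "continuous_on UNIV (\<lambda>t. Re (f t))"
    using isCont_char assms(2) by (intro continuous_at_imp_continuous_on ballI isCont_Re) simp
  moreover have "Re (f t) \<noteq> 0" for t
    using bound[of t] by (auto simp: not_le)
  moreover have "Re (f 0) > 0"
    using assms(2) char_zero by simp
  ultimately have "Re (f t) > 0" for t
    by (rule continuous_nonzero_pos)
  then have "\<bar>Re (f t)\<bar> = Re (f t)" for t
    by (simp add: less_imp_le)
  with bound real show ?thesis
    by simp
qed

end
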